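(* Let $E$ be a unital Banach algebra, $a<b$, and let $\mathcal I$ be the set of all compact subintervals of $[a,b]$. Consider a function $V:[a,b]\times\mathcal I\to E$ and assume that the following conditions are satisfied: 1. $V(\xi,[\xi,\xi])=I$ for each $\xi\in[a,b]$. 2. For each $\tau\in(a,b]$, $V(\tau,[x,\tau])$ is invertible whenever $x\le\tau$ is sufficiently close to $\tau$. 3. The generalized differential equation $x(s)=x(a)+\int_a^sD_t[U(\tau,t)x(\tau)]$, $s\in[a,b]$, where $U(\tau,t)=V(\tau,[\tau,t])$ for $t\ge\tau$ and $U(\tau,t)=V(\tau,[t,\tau])^{-1}$ for $t<\tau$, has a strong Kurzweil-Henstock solution $W:[a,b]\to E$ such that $W(t)^{-1}$ exists for all $t\in[a,b]$, and both $W$ and $W^{-1}$ are bounded. 4. $V$ is equivalent to the function $\tilde V$ given by $\tilde V(\xi,[x,y])=V(\xi,[\xi,y])V(\xi,[x,\xi])$. 5. There exist a constant $K\ge1$ and a gauge $\delta_1:[a,b]\to\mathbb R^+$ such that for each $\xi\in[a,b]$, we have $\|V(\xi,[x,\xi])\|\le K$ if $x\in(\xi-\delta_1(\xi),\xi]$, and $\|V(\xi,[\xi,y])\|\le K$ if $y\in[\xi,\xi+\delta_1(\xi))$ (with $x,y\in[a,b]$). Then $V$ is strongly Kurzweil product integrable and $\prod_a^bV(t,\mathrm dt)=W(b)W(a)^{-1}$.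
   Context: A unital Banach algebra is a complete normed algebra with unit $I$, $\|I\|=1$. $\mathcal I$ includes degenerate intervals $[t,t]$. A gauge is a function $\delta:[a,b]\to\mathbb R^+$ (positive values). Tagged partition of $[a,b]$: $(\xi_i,[t_{i-1},t_i])_{i=1}^m$ with $a=t_0<\dots<t_m=b$, $\xi_i\in[t_{i-1},t_i]$; it is $\delta$-fine if $[t_{i-1},t_i]\subset(\xi_i-\delta(\xi_i),\xi_i+\delta(\xi_i))$ for all $i$. $V$ is strongly Kurzweil product integrable if there is $W_0:[a,b]\to E$ with $W_0(t)$ invertible for all $t$, $W_0$ and $W_0^{-1}$ bounded, such that for every $\varepsilon>0$ there is a gauge $\delta$ with $\sum_{i=1}^m\|V(\xi_i,[t_{i-1},t_i])-W_0(t_i)W_0(t_{i-1})^{-1}\|<\varepsilon$ for every $\delta$-fine tagged partition; then $\prod_a^bV(t,\mathrm dt)=W_0(b)W_0(a)^{-1}$. Strong Kurzweil-Henstock solution: $x:[a,b]\to E$ is a strong Kurzweil-Henstock solution of the equation in condition 3 if for every $\varepsilon>0$ there is a gauge $\delta$ such that $\sum_{i=1}^m\|x(t_i)-x(t_{i-1})-(U(\xi_i,t_i)-U(\xi_i,t_{i-1}))x(\xi_i)\|<\varepsilon$ for every $\delta$-fine tagged partition of $[a,b]$. It suffices that for each $\tau$, $U(\tau,t)$ is defined for $t\in[a,b]$ sufficiently close to $\tau$ (gauges are then taken small enough that only defined values occur). $V_1,V_2:[a,b]\times\mathcal I\to E$ are equivalent if for every $\varepsilon>0$ there is a gauge $\delta$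 with $\sum_{i=1}^m\|V_1(\xi_i,[t_{i-1},t_i])-V_2(\xi_i,[t_{i-1},t_i])\|<\varepsilon$ for every $\delta$-fine tagged partition of $[a,b]$. (The values of $\tilde V(\xi,[x,y])$ matter only for $x\le\xi\le y$.) *)

theory Defs
  imports "HOL-Analysis.Analysis"
begin

text \<open>
  A unital Banach algebra is a type of sort \<open>{real_normed_algebra_1, banach}\<close>; a complex
  algebra is covered by restriction of scalars. The ring need not be commutative, so invertibility
  is two-sided.
\<close>

definition unit_elem :: "'a::ring_1 \<Rightarrow> bool" where
  "unit_elem x \<longleftrightarrow> (\<exists>y. x * y = 1 \<and> y * x = 1)"

definition inv_elem :: "'a::ring_1 \<Rightarrow> 'a" where
  "inv_elem x = (THE y. x * y = 1 \<and> y * x = 1)"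

definition gauge_on :: "real \<Rightarrow> real \<Rightarrow> (real \<Rightarrow> real) \<Rightarrow> bool" where
  "gauge_on a b \<delta> \<longleftrightarrow> (\<forall>\<xi>\<in>{a..b}. \<delta> \<xi> > 0)"

text \<open>
  Tags are numbered from 0: \<open>\<xi> i\<close> belongs to \<open>[t i, t (Suc i)]\<close> for \<open>i < m\<close>.
  Division points are strictly increasing, unlike in \<open>tagged_division_of\<close>, which admits
  degenerate subintervals.
\<close>

definition tagged_partition ::
  "real \<Rightarrow> real \<Rightarrow> nat \<Rightarrow> (nat \<Rightarrow> real) \<Rightarrow> (nat \<Rightarrow> real) \<Rightarrow> bool" where
  "tagged_partition a b m \<xi> t \<longleftrightarrow>
     t 0 = a \<and> t m = b \<and> (\<forall>i<m. t i < t (Suc i) \<and> \<xi> i \<in> {t i..t (Suc i)})"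

definition fine_partition ::
  "(real \<Rightarrow> real) \<Rightarrow> nat \<Rightarrow> (nat \<Rightarrow> real) \<Rightarrow> (nat \<Rightarrow> real) \<Rightarrow> bool" where
  "fine_partition \<delta> m \<xi> t \<longleftrightarrow>
     (\<forall>i<m. {t i..t (Suc i)} \<subseteq> {\<xi> i - \<delta> (\<xi> i)<..<\<xi> i + \<delta> (\<xi> i)})"

text \<open>
  The common pattern of all the definitions below: the sums of the norms of
  \<open>F (\<xi> i) (t i) (t (Suc i))\<close> are arbitrarily small over sufficiently fine tagged partitions.
\<close>

definition small_sums ::
  "real \<Rightarrow> real \<Rightarrow> (real \<Rightarrow> real \<Rightarrow> real \<Rightarrow> 'a::real_normed_vector) \<Rightarrow> bool" where
  "small_sums a b F \<longleftrightarrow>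
     (\<forall>\<epsilon>>0. \<exists>\<delta>. gauge_on a b \<delta> \<and>
        (\<forall>m \<xi> t. tagged_partition a b m \<xi> t \<and> fine_partition \<delta> m \<xi> t \<longrightarrow>
           (\<Sum>i<m. norm (F (\<xi> i) (t i) (t (Suc i)))) < \<epsilon>))"

text \<open>
  A map on \<open>[a,b] \<times> \<I>\<close> is a function of a point and a set of reals, of which only the values
  at points of \<open>[a,b]\<close> and compact intervals \<open>{x..y} \<subseteq> {a..b}\<close> are ever used.
\<close>

definition equivalent_on ::
  "real \<Rightarrow> real \<Rightarrow> (real \<Rightarrow> real set \<Rightarrow> 'a::real_normed_vector)
     \<Rightarrow> (real \<Rightarrow> real set \<Rightarrow> 'a) \<Rightarrow> bool" where
  "equivalent_on a b V\<^sub>1 V\<^sub>2 \<longleftrightarrow> small_sums a b (\<lambda>\<xi> x y. V\<^sub>1 \<xi> {x..y} - V\<^sub>2 \<xi> {x..y})"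

definition has_strong_Kurzweil_product ::
  "(real \<Rightarrow> real set \<Rightarrow> 'a::{real_normed_algebra_1, banach}) \<Rightarrow> real \<Rightarrow> real \<Rightarrow> 'a \<Rightarrow> bool" where
  "has_strong_Kurzweil_product V a b P \<longleftrightarrow>
     (\<exists>W\<^sub>0. (\<forall>t\<in>{a..b}. unit_elem (W\<^sub>0 t)) \<and>
           bounded (W\<^sub>0 ` {a..b}) \<and> bounded ((\<lambda>t. inv_elem (W\<^sub>0 t)) ` {a..b}) \<and>
           small_sums a b (\<lambda>\<xi> x y. V \<xi> {x..y} - W\<^sub>0 y * inv_elem (W\<^sub>0 x)) \<and>
           P = W\<^sub>0 b * inv_elem (W\<^sub>0 a))"

definition strongly_Kurzweil_product_integrable ::
  "(real \<Rightarrow> real set \<Rightarrow> 'a::{real_normed_algebra_1, banach}) \<Rightarrow> real \<Rightarrow> real \<Rightarrow> bool" where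
  "strongly_Kurzweil_product_integrable V a b \<longleftrightarrow> (\<exists>P. has_strong_Kurzweil_product V a b P)"

definition Kurzweil_product_integral ::
  "(real \<Rightarrow> real set \<Rightarrow> 'a::{real_normed_algebra_1, banach}) \<Rightarrow> real \<Rightarrow> real \<Rightarrow> 'a" where
  "Kurzweil_product_integral V a b = (THE P. has_strong_Kurzweil_product V a b P)"

text \<open>
  Strong Kurzweil-Henstock solution on \<open>[a,b]\<close> of
  \<open>x(s) = x(a) + \<integral>\<^sub>a\<^sup>s D\<^sub>t[U(\<tau>,t) x(\<tau>)]\<close>.
  If \<open>U \<tau> t\<close> is meaningful only for \<open>t\<close> sufficiently close to \<open>\<tau>\<close>, the gauge can always be
  shrunk so that no other values of \<open>U\<close> occur, so its values elsewhere are immaterial.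
\<close>

definition strong_KH_solution ::
  "real \<Rightarrow> real \<Rightarrow> (real \<Rightarrow> real \<Rightarrow> 'a::{real_normed_algebra_1, banach}) \<Rightarrow> (real \<Rightarrow> 'a) \<Rightarrow> bool" where
  "strong_KH_solution a b U x \<longleftrightarrow>
     small_sums a b (\<lambda>\<xi> s t. x t - x s - (U \<xi> t - U \<xi> s) * x \<xi>)"

definition U_of ::
  "(real \<Rightarrow> real set \<Rightarrow> 'a::{real_normed_algebra_1, banach}) \<Rightarrow> real \<Rightarrow> real \<Rightarrow> 'a" where
  "U_of V \<tau> t = (if \<tau> \<le> t then V \<tau> {\<tau>..t} else inv_elem (V \<tau> {t..\<tau>}))"

text \<open>
  \<open>split_at_tag V \<xi> {x..y} = V \<xi> {\<xi>..y} * V \<xi> {x..\<xi>}\<close>, relevant for \<open>x \<le> \<xi> \<le> y\<close> only.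
\<close>

definition split_at_tag ::
  "(real \<Rightarrow> real set \<Rightarrow> 'a::{real_normed_algebra_1, banach}) \<Rightarrow> real \<Rightarrow> real set \<Rightarrow> 'a" where
  "split_at_tag V \<xi> J = V \<xi> {\<xi>..Sup J} * V \<xi> {Inf J..\<xi>}"

end

theory Submission
  imports Defs
begin

text \<open>
  For \<open>x \<le> \<xi> \<le> y\<close> put \<open>r\<^sub>1 = W y - U \<xi> y * W \<xi>\<close> and \<open>r\<^sub>2 = U \<xi> x * W \<xi> - W x\<close>. Splitting each interval
  of a fine partition at its tag again gives a fine partition, so the Kurzweil-Henstock condition
  makes the sums of \<open>norm r\<^sub>1 + norm r\<^sub>2\<close> small. The identity
  \<open>W y * W x\<^sup>-\<^sup>1 - V \<xi> [\<xi>,y] * V \<xi> [x,\<xi>] = r\<^sub>1 * W x\<^sup>-\<^sup>1 + V \<xi> [\<xi>,y] * V \<xi> [x,\<xi>] * r\<^sub>2 * W x\<^sup>-\<^sup>1\<close>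
  and the bounds on \<open>V\<close> and \<open>W\<^sup>-\<^sup>1\<close> then show that the split form of \<open>V\<close>, hence \<open>V\<close> itself, is
  close to \<open>W y * W x\<^sup>-\<^sup>1\<close>. The value of the product is unique because for two admissible functions
  \<open>W\<^sub>0\<close>, \<open>W\<^sub>1\<close> the function \<open>W\<^sub>1\<^sup>-\<^sup>1 * W\<^sub>0\<close> has arbitrarily small variation sums over fine partitions,
  which exist by Cousin's lemma.
\<close>

section \<open>Two-sided inverses\<close>

lemma inv_elem_equality:
  fixes x y :: "'a::ring_1"
  assumes "x * y = 1" "y * x = 1"
  shows "inv_elem x = y"
  unfolding inv_elem_def
proof (rule the_equality)
  fix z assume z: "x * z = 1 \<and> z * x = 1"
  have "z = (y * x) * z" using assms by simp
  also have "\<dots> = y" using z by (simp add: mult.assoc)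
  finally show "z = y" .
qed (use assms in simp)

lemma unit_elem_inv_elem:
  fixes x :: "'a::ring_1"
  assumes "unit_elem x"
  shows "x * inv_elem x = 1" "inv_elem x * x = 1"
  using assms inv_elem_equality unfolding unit_elem_def by metis+

section \<open>Extending, constructing and refining fine tagged partitions\<close>

lemma tagged_partition_bounds:
  assumes "tagged_partition a b m \<xi> t" "i \<le> m"
  shows "a \<le> t i" "t i \<le> b"
proof -
  have step: "t j \<le> t (Suc j)" if "j < m" for j
    using assms(1) that unfolding tagged_partition_def by (meson less_imp_le)
  have up: "i \<le> m \<Longrightarrow> t 0 \<le> t i" for i
    by (induction i) (use step order_trans in \<open>auto simp: Suc_le_eq\<close>)
  have "t i \<le> t m"
    using assms(2) by (induction rule: inc_induct) (use step order_trans in auto)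
  then show "a \<le> t i" "t i \<le> b"
    using up[OF assms(2)] assms(1) unfolding tagged_partition_def by auto
qed

text \<open>The sum of an arbitrary \<open>G\<close> is carried along so that one extension step
  serves both Cousin's lemma, where \<open>G\<close> is zero, and the splitting at tags.\<close>

lemma tagged_partition_append:
  fixes G :: "real \<Rightarrow> real \<Rightarrow> real \<Rightarrow> real"
  assumes "tagged_partition a c m \<xi> t" "fine_partition \<delta> m \<xi> t"
    and "c < d" "\<tau> \<in> {c..d}" "{c..d} \<subseteq> {\<tau> - \<delta> \<tau><..<\<tau> + \<delta> \<tau>}"
  obtains \<xi>' t' where "tagged_partition a d (Suc m) \<xi>' t'" "fine_partition \<delta> (Suc m) \<xi>' t'"
    "(\<Sum>i<Suc m. G (\<xi>' i) (t' i) (t' (Suc i))) = (\<Sum>i<m. G (\<xi> i) (t i) (t (Suc i))) + G \<tau> c d"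
proof
  let ?\<xi> = "\<xi>(m := \<tau>)" and ?t = "t(Suc m := d)"
  show "tagged_partition a d (Suc m) ?\<xi> ?t" "fine_partition \<delta> (Suc m) ?\<xi> ?t"
    using assms by (auto simp: tagged_partition_def fine_partition_def less_Suc_eq)
  show "(\<Sum>i<Suc m. G (?\<xi> i) (?t i) (?t (Suc i)))
      = (\<Sum>i<m. G (\<xi> i) (t i) (t (Suc i))) + G \<tau> c d"
    using assms(1) by (auto simp: tagged_partition_def intro!: sum.cong)
qed

text \<open>Cousin's lemma by bisection: the relation "\<open>Q u\<close> implies
  \<open>Q v\<close>" is transitive, and near each point \<open>x\<close> it holds because a short
  interval around \<open>x\<close> can be appended with tag \<open>x\<close>.\<close>

lemma fine_partition_exists:
  assumes "a \<le> b" "gauge_on a b \<delta>"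
  shows "\<exists>m \<xi> t. tagged_partition a b m \<xi> t \<and> fine_partition \<delta> m \<xi> t"
proof -
  define Q where "Q c \<longleftrightarrow> (\<exists>m \<xi> t. tagged_partition a c m \<xi> t \<and> fine_partition \<delta> m \<xi> t)" for c
  have "Q a \<longrightarrow> Q b"
    using assms(1)
  proof (induction rule: Bolzano)
    case (local x)
    \<comment> \<open>The length \<open>\<delta> x\<close> is the local radius that bisection asks
      for. The case \<open>u = v\<close> stands apart because an appended interval must be
      nondegenerate.\<close>
    have "Q v" if uv: "u \<le> x" "x \<le> v" "v - u < \<delta> x" and "Q u" for u v
    proof (cases "u = v")
      case False
      obtain m \<xi> t where "tagged_partition a u m \<xi> t" "fine_partition \<delta> m \<xi> t"
        using \<open>Q u\<close> unfolding Q_def by blast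
      moreover have "u < v" "x \<in> {u..v}" "{u..v} \<subseteq> {x - \<delta> x<..<x + \<delta> x}"
        using uv False by auto
      ultimately show ?thesis
        unfolding Q_def by (rule tagged_partition_append[where G = "\<lambda>_ _ _. 0"]) blast
    qed (use \<open>Q u\<close> in simp)
    moreover have "\<delta> x > 0"
      using local assms(2) by (simp add: gauge_on_def)
    ultimately show ?case by blast
  qed auto
  \<comment> \<open>The empty partition, with \<open>m = 0\<close>, covers the degenerate
    interval.\<close>
  moreover have "Q a"
    unfolding Q_def tagged_partition_def fine_partition_def by (intro exI[of _ 0]) auto
  ultimately show ?thesis by (simp add: Q_def)
qed

text \<open>Each interval is replaced by at most two, both keeping its tag and hence its fineness. A
  tag at an endpoint leaves a degenerate piece, which a partition cannot contain; \<open>G0\<close>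
  allows it to be dropped without changing the sum.\<close>

lemma split_partition_at_tags:
  fixes G :: "real \<Rightarrow> real \<Rightarrow> real \<Rightarrow> real"
  assumes G0: "\<And>\<tau>. G \<tau> \<tau> \<tau> = 0"
    and "tagged_partition a b m \<xi> t" "fine_partition \<delta> m \<xi> t"
  shows "\<exists>n \<zeta> s. tagged_partition a b n \<zeta> s \<and> fine_partition \<delta> n \<zeta> s \<and>
    (\<Sum>i<n. G (\<zeta> i) (s i) (s (Suc i)))
      = (\<Sum>i<m. G (\<xi> i) (t i) (\<xi> i) + G (\<xi> i) (\<xi> i) (t (Suc i)))"
  using assms(2,3)
proof (induction m arbitrary: b)
  case 0
  then show ?case by (intro exI[of _ 0]) (auto simp: tagged_partition_def fine_partition_def)
next
  case (Suc m)
  let ?S = "\<lambda>m. \<Sum>i<m. G (\<xi> i) (t i) (\<xi> i) + G (\<xi> i) (\<xi> i) (t (Suc i))"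
  define x \<tau> where "x = t m" and "\<tau> = \<xi> m"
  have b: "b = t (Suc m)" and \<tau>: "x \<le> \<tau>" "\<tau> \<le> b"
    and fine: "{x..b} \<subseteq> {\<tau> - \<delta> \<tau><..<\<tau> + \<delta> \<tau>}"
    using Suc.prems by (auto simp: tagged_partition_def fine_partition_def x_def \<tau>_def)
  have "tagged_partition a x m \<xi> t" "fine_partition \<delta> m \<xi> t"
    using Suc.prems by (auto simp: tagged_partition_def fine_partition_def x_def)
  from Suc.IH[OF this] obtain n \<zeta> s where 1: "tagged_partition a x n \<zeta> s" "fine_partition \<delta> n \<zeta> s"
    "(\<Sum>i<n. G (\<zeta> i) (s i) (s (Suc i))) = ?S m" by blast
  have "\<exists>n \<zeta> s. tagged_partition a \<tau> n \<zeta> s \<and> fine_partition \<delta> n \<zeta> s \<and>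
    (\<Sum>i<n. G (\<zeta> i) (s i) (s (Suc i))) = ?S m + G \<tau> x \<tau>"
  proof (cases "x = \<tau>")
    case True
    then show ?thesis using 1 G0 by auto
  next
    case False
    then have "x < \<tau>" "\<tau> \<in> {x..\<tau>}" "{x..\<tau>} \<subseteq> {\<tau> - \<delta> \<tau><..<\<tau> + \<delta> \<tau>}"
      using \<tau> fine by auto
    from tagged_partition_append[OF 1(1,2) this, of G] show ?thesis
      unfolding 1(3) by blast
  qed
  then obtain n \<zeta> s where 2: "tagged_partition a \<tau> n \<zeta> s" "fine_partition \<delta> n \<zeta> s"
    "(\<Sum>i<n. G (\<zeta> i) (s i) (s (Suc i))) = ?S m + G \<tau> x \<tau>" by blast
  have S: "?S (Suc m) = ?S m + G \<tau> x \<tau> + G \<tau> \<tau> b"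
    by (simp add: b x_def \<tau>_def)
  show ?case
  proof (cases "\<tau> = b")
    case True
    then show ?thesis using 2 G0 unfolding S by auto
  next
    case False
    then have "\<tau> < b" "\<tau> \<in> {\<tau>..b}" "{\<tau>..b} \<subseteq> {\<tau> - \<delta> \<tau><..<\<tau> + \<delta> \<tau>}"
      using \<tau> fine by auto
    from tagged_partition_append[OF 2(1,2) this, of G] show ?thesis
      unfolding 2(3) S by blast
  qed
qed

section \<open>Calculus of small sums\<close>

text \<open>The gauge for \<open>F\<close> works unchanged, since the refined partition is fine for
  the same gauge and its sum for \<open>F\<close> is exactly the sum to be estimated.\<close>

lemma small_sums_split_at_tag:
  fixes F :: "real \<Rightarrow> real \<Rightarrow> real \<Rightarrow> 'a::real_normed_vector"
  assumes "small_sums a b F" "\<And>\<tau>. F \<tau> \<tau> \<tau> = 0"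
  shows "small_sums a b (\<lambda>\<xi> x y. norm (F \<xi> x \<xi>) + norm (F \<xi> \<xi> y))"
  unfolding small_sums_def
proof (intro allI impI)
  fix \<epsilon> :: real assume "\<epsilon> > 0"
  then obtain \<delta> where "gauge_on a b \<delta>" and \<delta>:
    "\<And>m \<xi> t. tagged_partition a b m \<xi> t \<Longrightarrow> fine_partition \<delta> m \<xi> t \<Longrightarrow>
      (\<Sum>i<m. norm (F (\<xi> i) (t i) (t (Suc i)))) < \<epsilon>"
    using assms(1) unfolding small_sums_def by blast
  have "(\<Sum>i<m. norm (norm (F (\<xi> i) (t i) (\<xi> i)) + norm (F (\<xi> i) (\<xi> i) (t (Suc i))))) < \<epsilon>"
    if part: "tagged_partition a b m \<xi> t" "fine_partition \<delta> m \<xi> t" for m \<xi> t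
  proof -
    obtain n \<zeta> s where "tagged_partition a b n \<zeta> s" "fine_partition \<delta> n \<zeta> s"
      "(\<Sum>i<n. norm (F (\<zeta> i) (s i) (s (Suc i))))
        = (\<Sum>i<m. norm (F (\<xi> i) (t i) (\<xi> i)) + norm (F (\<xi> i) (\<xi> i) (t (Suc i))))"
      using split_partition_at_tags[of "\<lambda>\<tau> x y. norm (F \<tau> x y)", OF _ part] assms(2) by auto
    then show ?thesis using \<delta>[of n \<zeta> s] by simp
  qed
  with \<open>gauge_on a b \<delta>\<close> show "\<exists>\<delta>. gauge_on a b \<delta> \<and>
    (\<forall>m \<xi> t. tagged_partition a b m \<xi> t \<and> fine_partition \<delta> m \<xi> t \<longrightarrow>
      (\<Sum>i<m. norm (norm (F (\<xi> i) (t i) (\<xi> i)) + norm (F (\<xi> i) (\<xi> i) (t (Suc i))))) < \<epsilon>)"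
    by blast
qed

text \<open>A comparison principle. The bound is required only on intervals that are fine for
  \<open>\<delta>\<^sub>0\<close>, which is how hypotheses valid only near the tag can
  enter.\<close>

lemma small_sums_dominated:
  fixes F :: "real \<Rightarrow> real \<Rightarrow> real \<Rightarrow> 'a::real_normed_vector"
    and G :: "real \<Rightarrow> real \<Rightarrow> real \<Rightarrow> 'b::real_normed_vector"
    and H :: "real \<Rightarrow> real \<Rightarrow> real \<Rightarrow> 'c::real_normed_vector"
  assumes F: "small_sums a b F" and G: "small_sums a b G" and \<delta>\<^sub>0: "gauge_on a b \<delta>\<^sub>0" and "C > 0"
    and bound: "\<And>\<xi> x y. a \<le> x \<Longrightarrow> x \<le> \<xi> \<Longrightarrow> \<xi> \<le> y \<Longrightarrow> y \<le> b \<Longrightarrow>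
      {x..y} \<subseteq> {\<xi> - \<delta>\<^sub>0 \<xi><..<\<xi> + \<delta>\<^sub>0 \<xi>} \<Longrightarrow>
      norm (H \<xi> x y) \<le> C * (norm (F \<xi> x y) + norm (G \<xi> x y))"
  shows "small_sums a b H"
  unfolding small_sums_def
proof (intro allI impI)
  fix \<epsilon> :: real assume "\<epsilon> > 0"
  \<comment> \<open>Each of the two sums gets half of the tolerance, divided by the constant
    \<open>C\<close>.\<close>
  then have e: "\<epsilon> / (2 * C) > 0" using \<open>C > 0\<close> by simp
  obtain \<delta>\<^sub>1 where \<delta>\<^sub>1: "gauge_on a b \<delta>\<^sub>1" "\<And>m \<xi> t. tagged_partition a b m \<xi> t \<Longrightarrow>
      fine_partition \<delta>\<^sub>1 m \<xi> t \<Longrightarrow> (\<Sum>i<m. norm (F (\<xi> i) (t i) (t (Suc i)))) < \<epsilon> / (2 * C)"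
    using F e unfolding small_sums_def by blast
  obtain \<delta>\<^sub>2 where \<delta>\<^sub>2: "gauge_on a b \<delta>\<^sub>2" "\<And>m \<xi> t. tagged_partition a b m \<xi> t \<Longrightarrow>
      fine_partition \<delta>\<^sub>2 m \<xi> t \<Longrightarrow> (\<Sum>i<m. norm (G (\<xi> i) (t i) (t (Suc i)))) < \<epsilon> / (2 * C)"
    using G e unfolding small_sums_def by blast
  define \<delta> where "\<delta> \<xi> = min (\<delta>\<^sub>0 \<xi>) (min (\<delta>\<^sub>1 \<xi>) (\<delta>\<^sub>2 \<xi>))" for \<xi>
  have "(\<Sum>i<m. norm (H (\<xi> i) (t i) (t (Suc i)))) < \<epsilon>"
    if part: "tagged_partition a b m \<xi> t" "fine_partition \<delta> m \<xi> t" for m \<xi> t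
  proof -
    have sub: "{\<tau> - \<delta> \<tau><..<\<tau> + \<delta> \<tau>} \<subseteq> {\<tau> - \<delta>' \<tau><..<\<tau> + \<delta>' \<tau>}"
      if "\<delta>' \<in> {\<delta>\<^sub>0, \<delta>\<^sub>1, \<delta>\<^sub>2}" for \<delta>' \<tau>
      using that by (auto simp: \<delta>_def)
    have fine: "fine_partition \<delta>' m \<xi> t" if "\<delta>' \<in> {\<delta>\<^sub>0, \<delta>\<^sub>1, \<delta>\<^sub>2}" for \<delta>'
      using part(2) sub[OF that] unfolding fine_partition_def by (meson order_trans)
    have "(\<Sum>i<m. norm (H (\<xi> i) (t i) (t (Suc i))))
        \<le> (\<Sum>i<m. C * (norm (F (\<xi> i) (t i) (t (Suc i))) + norm (G (\<xi> i) (t i) (t (Suc i)))))"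
    proof (rule sum_mono)
      fix i assume "i \<in> {..<m}"
      then have i: "i < m" by simp
      show "norm (H (\<xi> i) (t i) (t (Suc i)))
          \<le> C * (norm (F (\<xi> i) (t i) (t (Suc i))) + norm (G (\<xi> i) (t i) (t (Suc i))))"
        using i tagged_partition_bounds[OF part(1), of i]
          tagged_partition_bounds[OF part(1), of "Suc i"] part(1) fine[of \<delta>\<^sub>0]
        by (intro bound) (auto simp: tagged_partition_def fine_partition_def)
    qed
    also have "\<dots> = C * ((\<Sum>i<m. norm (F (\<xi> i) (t i) (t (Suc i))))
        + (\<Sum>i<m. norm (G (\<xi> i) (t i) (t (Suc i)))))"
      by (simp only: sum_distrib_left sum.distrib[symmetric])
    also have "\<dots> < C * (\<epsilon> / (2 * C) + \<epsilon> / (2 * C))"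
      using \<delta>\<^sub>1(2)[OF part(1)] \<delta>\<^sub>2(2)[OF part(1)] fine \<open>C > 0\<close>
      by (intro mult_strict_left_mono add_strict_mono) auto
    also have "\<dots> = \<epsilon>" using \<open>C > 0\<close> by (simp add: field_simps)
    finally show ?thesis .
  qed
  moreover have "gauge_on a b \<delta>"
    using \<delta>\<^sub>0 \<delta>\<^sub>1(1) \<delta>\<^sub>2(1) by (simp add: gauge_on_def \<delta>_def)
  ultimately show "\<exists>\<delta>. gauge_on a b \<delta> \<and>
    (\<forall>m \<xi> t. tagged_partition a b m \<xi> t \<and> fine_partition \<delta> m \<xi> t \<longrightarrow>
      (\<Sum>i<m. norm (H (\<xi> i) (t i) (t (Suc i)))) < \<epsilon>)"
    by blast
qed

text \<open>If the end values differed, the norm of their difference could serve as the tolerance;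
  the increments over a fine partition telescope to that difference, a contradiction.\<close>

lemma small_sums_increments_imp_eq:
  fixes Z :: "real \<Rightarrow> 'a::real_normed_vector"
  assumes "a \<le> b" "small_sums a b (\<lambda>\<xi> x y. Z y - Z x)"
  shows "Z b = Z a"
proof (rule ccontr)
  assume "Z b \<noteq> Z a"
  then have "norm (Z b - Z a) > 0" by simp
  then obtain \<delta> where \<delta>: "gauge_on a b \<delta>" "\<And>m \<xi> t. tagged_partition a b m \<xi> t \<Longrightarrow>
      fine_partition \<delta> m \<xi> t \<Longrightarrow> (\<Sum>i<m. norm (Z (t (Suc i)) - Z (t i))) < norm (Z b - Z a)"
    using assms(2) unfolding small_sums_def by blast
  obtain m \<xi> t where part: "tagged_partition a b m \<xi> t" "fine_partition \<delta> m \<xi> t"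
    using fine_partition_exists[OF assms(1) \<delta>(1)] by blast
  have "Z b - Z a = (\<Sum>i<m. Z (t (Suc i)) - Z (t i))"
    using part(1) sum_lessThan_telescope[of "\<lambda>i. Z (t i)" m] by (simp add: tagged_partition_def)
  then have "norm (Z b - Z a) \<le> (\<Sum>i<m. norm (Z (t (Suc i)) - Z (t i)))"
    by (simp add: norm_sum)
  with \<delta>(2)[OF part] show False by simp
qed

section \<open>Uniqueness of the product integral\<close>

lemma norm_mult3_le:
  fixes x y z :: "'a::real_normed_algebra"
  shows "norm (x * y * z) \<le> norm x * norm y * norm z"
  by (meson norm_mult_ineq mult_right_mono norm_ge_zero order_trans)

text \<open>This is what makes the definite description in \<open>Kurzweil_product_integral\<close>
  denote the value found.\<close>

lemma has_strong_Kurzweil_product_unique: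
  fixes V :: "real \<Rightarrow> real set \<Rightarrow> 'a::{real_normed_algebra_1, banach}"
  assumes "a \<le> b"
    and P: "has_strong_Kurzweil_product V a b P" and Q: "has_strong_Kurzweil_product V a b Q"
  shows "P = Q"
proof -
  obtain X where uX: "\<And>t. t \<in> {a..b} \<Longrightarrow> unit_elem (X t)" and bX: "bounded (X ` {a..b})"
    and sX: "small_sums a b (\<lambda>\<xi> x y. V \<xi> {x..y} - X y * inv_elem (X x))"
    and P: "P = X b * inv_elem (X a)"
    using P unfolding has_strong_Kurzweil_product_def by blast
  obtain Y where uY: "\<And>t. t \<in> {a..b} \<Longrightarrow> unit_elem (Y t)"
    and bY: "bounded ((\<lambda>t. inv_elem (Y t)) ` {a..b})"
    and sY: "small_sums a b (\<lambda>\<xi> x y. V \<xi> {x..y} - Y y * inv_elem (Y x))"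
    and Q: "Q = Y b * inv_elem (Y a)"
    using Q unfolding has_strong_Kurzweil_product_def by blast
  note X = unit_elem_inv_elem[OF uX] and Y = unit_elem_inv_elem[OF uY]
  obtain M where M: "M > 0" "\<And>t. t \<in> {a..b} \<Longrightarrow> norm (X t) \<le> M"
    using bX unfolding bounded_pos by auto
  obtain N where N: "N > 0" "\<And>t. t \<in> {a..b} \<Longrightarrow> norm (inv_elem (Y t)) \<le> N"
    using bY unfolding bounded_pos by auto
  define Z where "Z t = inv_elem (Y t) * X t" for t
  have "small_sums a b (\<lambda>\<xi> x y. Z y - Z x)"
  proof (rule small_sums_dominated[OF sX sY, where \<delta>\<^sub>0 = "\<lambda>_. 1" and C = "N * M"])
    fix \<xi> x y :: real
    assume "a \<le> x" "x \<le> \<xi>" "\<xi> \<le> y" "y \<le> b"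
    then have xy: "x \<in> {a..b}" "y \<in> {a..b}" by auto
    let ?F = "V \<xi> {x..y} - X y * inv_elem (X x)" and ?G = "V \<xi> {x..y} - Y y * inv_elem (Y x)"
    \<comment> \<open>In \<open>?G - ?F\<close> the values of \<open>V\<close> cancel. The outer
      factors then remove \<open>Y y\<close> on the left of one product and
      \<open>inv_elem (X x)\<close> on the right of the other, leaving an increment of
      \<open>Z\<close>.\<close>
    have "inv_elem (Y y) * (?G - ?F) * X x
        = inv_elem (Y y) * X y * (inv_elem (X x) * X x) - inv_elem (Y y) * Y y * inv_elem (Y x) * X x"
      by (simp add: algebra_simps)
    then have "Z y - Z x = inv_elem (Y y) * (?G - ?F) * X x"
      using xy X Y by (simp add: Z_def)
    then have "norm (Z y - Z x) \<le> norm (inv_elem (Y y)) * norm (?G - ?F) * norm (X x)"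
      using norm_mult3_le by metis
    also have "\<dots> \<le> N * (norm ?F + norm ?G) * M"
      using xy M N norm_triangle_ineq4[of ?G ?F] by (intro mult_mono) auto
    finally show "norm (Z y - Z x) \<le> N * M * (norm ?F + norm ?G)"
      by (simp add: mult_ac)
  qed (use M N in \<open>auto simp: gauge_on_def\<close>)
  then have Z: "Z b = Z a"
    by (rule small_sums_increments_imp_eq[OF assms(1)])
  have ab: "a \<in> {a..b}" "b \<in> {a..b}" using assms(1) by auto
  \<comment> \<open>Both values have the form \<open>Y b * z * inv_elem (X a)\<close>, with
    \<open>z = Z b\<close> for \<open>P\<close> and \<open>z = Z a\<close> for
    \<open>Q\<close>.\<close>
  have "P = Y b * Z b * inv_elem (X a)"
    using ab Y by (simp add: P Z_def mult.assoc[symmetric])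
  also have "\<dots> = Q"
    unfolding Z using ab X by (simp add: Q Z_def mult.assoc)
  finally show ?thesis .
qed

section \<open>Existence and value of the product integral\<close>

lemma U_of_left_inverse:
  fixes V :: "real \<Rightarrow> real set \<Rightarrow> 'a::{real_normed_algebra_1, banach}"
  assumes "x \<le> \<xi>" "V \<xi> {\<xi>..\<xi>} = 1" "unit_elem (V \<xi> {x..\<xi>})"
  shows "V \<xi> {x..\<xi>} * U_of V \<xi> x = 1"
\<comment> \<open>At \<open>x = \<xi>\<close> the definition of \<open>U_of\<close> takes the branch
  without inversion, and both factors are 1.\<close>
proof (cases "x = \<xi>")
  case False
  with assms show ?thesis by (simp add: U_of_def unit_elem_inv_elem)
qed (use assms in \<open>simp add: U_of_def\<close>)

theorem theorem8p7:
  fixes a b :: real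
    and V :: "real \<Rightarrow> real set \<Rightarrow> 'a::{real_normed_algebra_1, banach}"
    and W :: "real \<Rightarrow> 'a"
  assumes "a < b"
    and "\<And>\<xi>. \<xi> \<in> {a..b} \<Longrightarrow> V \<xi> {\<xi>..\<xi>} = 1"
    and "\<And>\<tau>. \<tau> \<in> {a<..b} \<Longrightarrow>
           \<exists>\<eta>>0. \<forall>x. a \<le> x \<and> x \<le> \<tau> \<and> \<tau> - x < \<eta> \<longrightarrow> unit_elem (V \<tau> {x..\<tau>})"
    and "strong_KH_solution a b (U_of V) W"
    and "\<And>t. t \<in> {a..b} \<Longrightarrow> unit_elem (W t)"
    and "bounded (W ` {a..b})"
    and "bounded ((\<lambda>t. inv_elem (W t)) ` {a..b})"
    and "equivalent_on a b V (split_at_tag V)"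
    and "\<exists>K \<delta>\<^sub>1. K \<ge> 1 \<and> gauge_on a b \<delta>\<^sub>1 \<and>
           (\<forall>\<xi>\<in>{a..b}.
              (\<forall>x\<in>{a..b}. x \<in> {\<xi> - \<delta>\<^sub>1 \<xi><..\<xi>} \<longrightarrow> norm (V \<xi> {x..\<xi>}) \<le> K) \<and>
              (\<forall>y\<in>{a..b}. y \<in> {\<xi>..<\<xi> + \<delta>\<^sub>1 \<xi>} \<longrightarrow> norm (V \<xi> {\<xi>..y}) \<le> K))"
  shows "strongly_Kurzweil_product_integrable V a b \<and>
         Kurzweil_product_integral V a b = W b * inv_elem (W a)"
proof -
  note one = assms(2) and ex_inv = assms(3)
  note inv_W = unit_elem_inv_elem[OF assms(5)]
  obtain K \<delta>\<^sub>1 where K: "K \<ge> 1" and \<delta>\<^sub>1: "gauge_on a b \<delta>\<^sub>1"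
    and K_left: "\<And>\<xi> x. \<xi> \<in> {a..b} \<Longrightarrow> x \<in> {a..b} \<Longrightarrow> x \<in> {\<xi> - \<delta>\<^sub>1 \<xi><..\<xi>} \<Longrightarrow> norm (V \<xi> {x..\<xi>}) \<le> K"
    and K_right: "\<And>\<xi> y. \<xi> \<in> {a..b} \<Longrightarrow> y \<in> {a..b} \<Longrightarrow> y \<in> {\<xi>..<\<xi> + \<delta>\<^sub>1 \<xi>} \<Longrightarrow> norm (V \<xi> {\<xi>..y}) \<le> K"
    using assms(9) by blast
  \<comment> \<open>The hypothesis speaks of \<tau> > a only. At \<open>\<tau> = a\<close> the sole
    admissible \<open>x\<close> is \<open>a\<close> itself, where \<open>V\<close> is 1.\<close>
  have "\<exists>\<eta>>0. \<forall>x. a \<le> x \<and> x \<le> \<tau> \<and> \<tau> - x < \<eta> \<longrightarrow> unit_elem (V \<tau> {x..\<tau>})" if "\<tau> \<in> {a..b}" for \<tau>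
  proof (cases "\<tau> = a")
    case True
    then have "unit_elem (V \<tau> {x..\<tau>})" if "a \<le> x" "x \<le> \<tau>" for x
      using that one[OF \<open>\<tau> \<in> {a..b}\<close>] by (auto simp: unit_elem_def)
    then show ?thesis using zero_less_one by blast
  qed (use ex_inv that in auto)
  \<comment> \<open>The radii of invertibility are chosen as a function of the tag, so that they
    form a gauge.\<close>
  then obtain \<eta> where \<eta>: "\<And>\<tau>. \<tau> \<in> {a..b} \<Longrightarrow> \<eta> \<tau> > 0"
    "\<And>\<tau> x. \<tau> \<in> {a..b} \<Longrightarrow> a \<le> x \<Longrightarrow> x \<le> \<tau> \<Longrightarrow> \<tau> - x < \<eta> \<tau> \<Longrightarrow> unit_elem (V \<tau> {x..\<tau>})"
    by metis
  obtain M where M: "M > 0" "\<And>t. t \<in> {a..b} \<Longrightarrow> norm (inv_elem (W t)) \<le> M"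
    using assms(7) unfolding bounded_pos by auto
  \<comment> \<open>Since \<open>U_of V \<xi> \<xi>\<close> is 1 for \<open>\<xi>\<close> in the
    interval, \<open>R \<xi> \<xi> y\<close> and \<open>R \<xi> x \<xi>\<close> are the remainders
    \<open>r\<^sub>1\<close> and \<open>r\<^sub>2\<close>.\<close>
  define R where "R \<xi> s t = W t - W s - (U_of V \<xi> t - U_of V \<xi> s) * W \<xi>" for \<xi> s t
  have "small_sums a b R"
    using assms(4) unfolding strong_KH_solution_def R_def .
  then have R: "small_sums a b (\<lambda>\<xi> x y. norm (R \<xi> x \<xi>) + norm (R \<xi> \<xi> y))"
    by (rule small_sums_split_at_tag) (simp add: R_def)
  have "small_sums a b (\<lambda>\<xi> x y. V \<xi> {x..y} - W y * inv_elem (W x))"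
  \<comment> \<open>The gauge secures the bounds \<open>K\<close> and the invertibility of
    \<open>V \<xi> {x..\<xi>}\<close>. In \<open>C\<close>, the summand 1 pays for replacing
    \<open>V\<close> by its split form and \<open>K * K * M\<close> for comparing the split form
    with \<open>W\<close>.\<close>
  proof (rule small_sums_dominated[OF assms(8)[unfolded equivalent_on_def] R,
        where \<delta>\<^sub>0 = "\<lambda>\<xi>. min (\<delta>\<^sub>1 \<xi>) (\<eta> \<xi>)" and C = "1 + K * K * M"])
    show "gauge_on a b (\<lambda>\<xi>. min (\<delta>\<^sub>1 \<xi>) (\<eta> \<xi>))"
      using \<delta>\<^sub>1 \<eta> by (simp add: gauge_on_def)
    show "1 + K * K * M > 0"
      using K M by (simp add: add_pos_pos)
    fix \<xi> x y
    assume xy: "a \<le> x" "x \<le> \<xi>" "\<xi> \<le> y" "y \<le> b"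
      and fine: "{x..y} \<subseteq> {\<xi> - min (\<delta>\<^sub>1 \<xi>) (\<eta> \<xi>)<..<\<xi> + min (\<delta>\<^sub>1 \<xi>) (\<eta> \<xi>)}"
    have mem: "x \<in> {a..b}" "y \<in> {a..b}" "\<xi> \<in> {a..b}" using xy by auto
    have "x \<in> {x..y}" "y \<in> {x..y}" using xy by auto
    then have near: "\<xi> - x < \<delta>\<^sub>1 \<xi>" "\<xi> - x < \<eta> \<xi>" "y - \<xi> < \<delta>\<^sub>1 \<xi>"
      using subsetD[OF fine, of x] subsetD[OF fine, of y] by auto
    define A B u w where "A = V \<xi> {\<xi>..y}" and "B = V \<xi> {x..\<xi>}" and "u = U_of V \<xi> x"
      and "w = inv_elem (W x)"
    define r where "r = norm (R \<xi> x \<xi>) + norm (R \<xi> \<xi> y)"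
    have AB: "norm A \<le> K" "norm B \<le> K"
      using K_left K_right mem near xy by (auto simp: A_def B_def)
    have Bu: "B * u = 1"
      unfolding B_def u_def
      using U_of_left_inverse xy one mem \<eta>(2) near by blast
    have Ww: "W x * w = 1" and w: "norm w \<le> M"
      using inv_W M mem by (auto simp: w_def)
    have R1: "R \<xi> \<xi> y = W y - A * W \<xi>" and R2: "R \<xi> x \<xi> = u * W \<xi> - W x"
      using xy one[OF mem(3)] by (auto simp: R_def A_def u_def U_of_def algebra_simps)
    \<comment> \<open>By \<open>B * u = 1\<close> the first term on the right is
      \<open>A * W \<xi> * w\<close>, which cancels its counterpart in
      \<open>R \<xi> \<xi> y * w\<close>.\<close>
    have "A * B * R \<xi> x \<xi> * w = A * (B * u) * W \<xi> * w - A * B * (W x * w)"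
      unfolding R2 by (simp add: algebra_simps)
    then have "A * B - W y * w = - (R \<xi> \<xi> y * w + A * B * R \<xi> x \<xi> * w)"
      unfolding R1 Bu Ww by (simp add: algebra_simps)
    then have "norm (A * B - W y * w) \<le> norm (R \<xi> \<xi> y * w) + norm (A * B * R \<xi> x \<xi> * w)"
      by (simp only: norm_minus_cancel norm_triangle_ineq)
    also have "\<dots> \<le> norm (R \<xi> \<xi> y) * norm w + norm (A * B) * norm (R \<xi> x \<xi>) * norm w"
      by (intro add_mono norm_mult_ineq norm_mult3_le)
    also have "\<dots> \<le> norm (R \<xi> \<xi> y) * (K * K * M) + K * K * norm (R \<xi> x \<xi>) * M"
    proof (intro add_mono mult_mono order_trans[OF norm_mult_ineq] AB w)
      \<comment> \<open>The weaker bound \<open>K * K * M\<close> for \<open>w\<close>, available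
        because K \<ge> 1, gives both remainders the same coefficient.\<close>
      have "1 * 1 \<le> K * K" using K by (intro mult_mono) auto
      then have "1 * M \<le> K * K * M" using M(1) by (intro mult_right_mono) auto
      then show "norm w \<le> K * K * M" using w by linarith
    qed (use K M in auto)
    also have "\<dots> = K * K * M * r"
      by (simp add: r_def algebra_simps)
    finally have split: "norm (A * B - W y * w) \<le> K * K * M * r" .
    have "split_at_tag V \<xi> {x..y} = A * B"
      using xy by (simp add: split_at_tag_def A_def B_def)
    then have "norm (V \<xi> {x..y} - W y * w)
        \<le> norm (V \<xi> {x..y} - split_at_tag V \<xi> {x..y}) + norm (A * B - W y * w)"
      using norm_triangle_ineq[of "V \<xi> {x..y} - A * B" "A * B - W y * w"] by simp
    also have "\<dots> \<le> (1 + K * K * M) * norm (V \<xi> {x..y} - split_at_tag V \<xi> {x..y})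
        + (1 + K * K * M) * r"
    proof -
      have "0 \<le> r" "0 \<le> K * K * M" using K M by (auto simp: r_def)
      then show ?thesis
        using split by (intro add_mono) (auto simp: distrib_right)
    qed
    finally show "norm (V \<xi> {x..y} - W y * inv_elem (W x))
        \<le> (1 + K * K * M) * (norm (V \<xi> {x..y} - split_at_tag V \<xi> {x..y})
          + norm (norm (R \<xi> x \<xi>) + norm (R \<xi> \<xi> y)))"
      unfolding w_def r_def by (simp add: distrib_left)
  qed
  then have "has_strong_Kurzweil_product V a b (W b * inv_elem (W a))"
    unfolding has_strong_Kurzweil_product_def using assms(5-7) by blast
  then show ?thesis
    unfolding strongly_Kurzweil_product_integrable_def Kurzweil_product_integral_def
    using has_strong_Kurzweil_product_unique assms(1) by (blast intro: the_equality less_imp_le)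
qed

end
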